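(* Let $X$ be a hyperbolic Riemann surface and let $\mathscr{F}$ be a subfamily of $\mathrm{Hol}(X,X)$ for which $\mathrm{id}_X\notin\overline{\mathscr{F}}$. Let $f_n\in\mathscr{F}$ for $n\ge1$ and suppose that the left iterated function system $L_n=f_n\circ f_{n-1}\circ\dots\circ f_1$ converges on $X$ to a constant $a$ in $X$. Then, for sufficiently large $n$, the map $f_n$ has a fixed point $a_n\in X$, and these fixed points can be chosen such that $a_n\to a$.
   Context: $\mathrm{Hol}(X,X)$ is the space of holomorphic self-maps of $X$ with the compact-open topology, so convergence is uniform convergence on compact subsets of $X$; $\overline{\mathscr{F}}$ is the closure of $\mathscr{F}$ in $\mathrm{Hol}(X,X)$, and $\mathrm{id}_X$ is the identity map of $X$. *)

theory Defs
  imports "HOL-Analysis.Analysis"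
begin

text \<open>
  A Riemann surface is given by a set \<open>X\<close> in a Hausdorff type, carrying the subspace topology,
  together with a holomorphic atlas \<open>A\<close>. Only the values of a chart \<open>(U, \<phi>)\<close> on \<open>U\<close> are
  relevant. The atlas need not be maximal.
\<close>

type_synonym 'a chart = "'a set \<times> ('a \<Rightarrow> complex)"

definition complex_chart :: "'a::topological_space set \<Rightarrow> 'a chart \<Rightarrow> bool" where
  "complex_chart X = (\<lambda>(U, \<phi>).
     openin (top_of_set X) U \<and> open (\<phi> ` U) \<and> homeomorphism U (\<phi> ` U) \<phi> (inv_into U \<phi>))"

definition holomorphic_atlas :: "'a::topological_space set \<Rightarrow> 'a chart set \<Rightarrow> bool" where
  "holomorphic_atlas X A \<longleftrightarrow>
     (\<forall>c\<in>A. complex_chart X c) \<and> (\<Union>(U, \<phi>)\<in>A. U) = X \<and>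
     (\<forall>(U, \<phi>)\<in>A. \<forall>(V, \<psi>)\<in>A. (\<psi> \<circ> inv_into U \<phi>) holomorphic_on \<phi> ` (U \<inter> V))"

text \<open>
  The Hausdorff property comes from the type class; second countability is not imposed, being
  automatic by the theorem of Rado.
\<close>

definition riemann_surface :: "'a::t2_space set \<Rightarrow> 'a chart set \<Rightarrow> bool" where
  "riemann_surface X A \<longleftrightarrow> X \<noteq> {} \<and> connected X \<and> holomorphic_atlas X A"

definition holomorphic_map ::
    "'a::topological_space set \<Rightarrow> 'a chart set \<Rightarrow> 'b::topological_space set \<Rightarrow> 'b chart set
      \<Rightarrow> ('a \<Rightarrow> 'b) \<Rightarrow> bool" where
  "holomorphic_map X A Y B f \<longleftrightarrow>
     continuous_on X f \<and> f \<in> X \<rightarrow> Y \<and>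
     (\<forall>(U, \<phi>)\<in>A. \<forall>(V, \<psi>)\<in>B. (\<psi> \<circ> f \<circ> inv_into U \<phi>) holomorphic_on \<phi> ` (U \<inter> f -` V))"

abbreviation unit_disc :: "complex set" where
  "unit_disc \<equiv> ball 0 1"

abbreviation unit_disc_atlas :: "complex chart set" where
  "unit_disc_atlas \<equiv> {(unit_disc, \<lambda>z. z)}"

text \<open>
  Hyperbolic means that the universal covering surface is the unit disc. As the disc is simply
  connected, any holomorphic covering map from it is the universal covering.
\<close>

definition hyperbolic_riemann_surface :: "'a::t2_space set \<Rightarrow> 'a chart set \<Rightarrow> bool" where
  "hyperbolic_riemann_surface X A \<longleftrightarrow>
     riemann_surface X A \<and>
     (\<exists>p. covering_space unit_disc p X \<and> holomorphic_map unit_disc unit_disc_atlas X A p)"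

text \<open>
  Elements of \<open>Hol X A\<close> have arbitrary values outside \<open>X\<close>. This is harmless in what follows:
  the open sets of the compact-open topology below do not distinguish functions that agree
  on \<open>X\<close>, so neither closures nor limits depend on those values.
\<close>

definition Hol :: "'a::t2_space set \<Rightarrow> 'a chart set \<Rightarrow> ('a \<Rightarrow> 'a) set" where
  "Hol X A = {f. holomorphic_map X A X A f}"

definition Hol_topology :: "'a::t2_space set \<Rightarrow> 'a chart set \<Rightarrow> ('a \<Rightarrow> 'a) topology" where
  "Hol_topology X A = topology_generated_by
     {{f \<in> Hol X A. f ` K \<subseteq> U} | K U. compact K \<and> K \<subseteq> X \<and> openin (top_of_set X) U}"

lemma topspace_Hol_topology [simp]: "topspace (Hol_topology X A) = Hol X A"
proof -
  have "Hol X A \<in> {{f \<in> Hol X A. f ` K \<subseteq> U} | K U.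
          compact K \<and> K \<subseteq> X \<and> openin (top_of_set X) U}"
    by (rule CollectI, rule exI[of _ "{}"], rule exI[of _ "{}"]) simp
  then show ?thesis
    unfolding Hol_topology_def topology_generated_by_topspace by blast
qed

lemma id_in_Hol:
  assumes "riemann_surface X A"
  shows "id \<in> Hol X A"
  using assms
  by (auto simp: Hol_def holomorphic_map_def riemann_surface_def holomorphic_atlas_def
           simp flip: id_def)

lemma const_in_Hol:
  assumes "a \<in> X"
  shows "(\<lambda>_. a) \<in> Hol X A"
  using assms by (auto simp: Hol_def holomorphic_map_def o_def)

text \<open>The left iterated function system \<open>f n \<circ> \<dots> \<circ> f 1\<close>; the value \<open>f 0\<close> is not used.\<close>

fun left_ifs :: "(nat \<Rightarrow> 'a \<Rightarrow> 'a) \<Rightarrow> nat \<Rightarrow> 'a \<Rightarrow> 'a" where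
  "left_ifs f 0 = id"
| "left_ifs f (Suc n) = f (Suc n) \<circ> left_ifs f n"

end

theory Submission
  imports Defs "HOL-Complex_Analysis.Complex_Analysis"
begin

text \<open>
  The orbit \<open>c n = left_ifs f n a\<close> tends to \<open>a\<close>, and \<open>f (n + 1)\<close> maps \<open>c n\<close> to \<open>c (n + 1)\<close>. So
  \<open>f (n + 1)\<close> moves a point near \<open>a\<close> by very little, and as the
  surface is hyperbolic, these maps form a normal family. If
  along some subsequence the maps had no fixed point close to \<open>a\<close>, then a further subsequence would
  have a limit \<open>g\<close> with \<open>g a = a\<close>. Unless \<open>g\<close> is the identity, \<open>a\<close> is an isolated zero of
  \<open>g z - z\<close> in a local coordinate, and by Hurwitz's theorem the approximating maps have fixed
  points near \<open>a\<close>. Hence \<open>g\<close> is the identity, which thus lies in the closure of the family; this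
  is excluded by hypothesis.

  Normality and Hurwitz's theorem are used in the unit disc rather than on the surface. Points of the
  orbit close to \<open>a\<close> are lifted by a local inverse of the universal covering \<open>p\<close>, and each
  \<open>f (n + 1) \<circ> p\<close> is lifted to the holomorphic self-map \<open>G\<close> of the disc that sends one lifted
  orbit point to the next (\<open>covering_space_lift_to_topological_space\<close>, \<open>holomorphic_lift\<close>). The
  argument above, in the disc, is \<open>eventually_fixed_point_near_limit\<close>. Its outcome passes to the
  surface in two ways: fixed points of a lift project to fixed points, and lifts tending to the
  identity force the maps below to do so, because compact sets lift to compact sets
  (\<open>covering_space_compact_lift\<close>, \<open>limitin_Hol_id_if_lifts_tend_to_id\<close>).
\<close>

section \<open>Covering spaces\<close>

text \<open>
  Near each point \<open>p\<close> is a homeomorphism onto an open set, so the image of \<open>T\<close> is a union of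
  open images of local pieces.
\<close>

lemma covering_space_is_open_map:
  assumes cov: "covering_space C p X" and T: "openin (top_of_set C) T"
  shows "openin (top_of_set X) (p ` T)"
proof (subst openin_subopen, intro ballI)
  fix y assume "y \<in> p ` T"
  then obtain x where x: "x \<in> T" "y = p x" by blast
  have "x \<in> C" using x T openin_imp_subset by blast
  then obtain U V q where U: "x \<in> U" "openin (top_of_set C) U"
    and V: "openin (top_of_set X) V" and hom: "homeomorphism U V p q"
    using covering_space_local_homeomorphism[OF cov] by metis
  have "openin (top_of_set U) (U \<inter> T)"
    using T U openin_imp_subset[OF U(2)]
    by (metis Int_commute openin_Int openin_subset_trans inf_le1)
  then have "openin (top_of_set V) (p ` (U \<inter> T))"
    using homeomorphism_imp_open_map[OF hom] by blast
  then have "openin (top_of_set X) (p ` (U \<inter> T))"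
    using V openin_trans by blast
  then show "\<exists>W. openin (top_of_set X) W \<and> y \<in> W \<and> W \<subseteq> p ` T"
    using x U by blast
qed

text \<open>
  Over \<open>g -` T\<close>, where \<open>T\<close> is evenly covered by sheets \<open>u\<close> with local inverses \<open>q\<close>, the fibre
  product splits into the graphs of \<open>q \<circ> g\<close>. The value of the construction is that it trades a
  covering of \<open>X\<close> for one of \<open>S\<close>, whose sections are the lifts of \<open>g\<close>.
\<close>

lemma covering_space_pullback:
  fixes p :: "'a::topological_space \<Rightarrow> 'b::topological_space" and g :: "'c::topological_space \<Rightarrow> 'b"
  assumes cov: "covering_space C p X" and g: "continuous_on S g" "g \<in> S \<rightarrow> X"
  shows "covering_space {(z, w). z \<in> S \<and> w \<in> C \<and> p w = g z} fst S"
proof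
  let ?E = "{(z, w). z \<in> S \<and> w \<in> C \<and> p w = g z}"
  show "continuous_on ?E fst" by (intro continuous_intros)
  have "p ` C = X" using cov covering_space_imp_surjective by blast
  show "fst ` ?E = S"
  proof
    show "S \<subseteq> fst ` ?E"
    proof
      fix z assume "z \<in> S"
      then obtain w where "w \<in> C" "p w = g z" using g(2) \<open>p ` C = X\<close> by (metis Pi_iff imageE)
      then show "z \<in> fst ` ?E" using \<open>z \<in> S\<close> by force
    qed
  qed auto
  fix x assume "x \<in> S"
  then have "g x \<in> X" using g(2) by auto
  then obtain T v where T: "g x \<in> T" "openin (top_of_set X) T" and v: "\<Union>v = C \<inter> p -` T"
    "\<And>u. u \<in> v \<Longrightarrow> openin (top_of_set C) u" "pairwise disjnt v"
    "\<And>u. u \<in> v \<Longrightarrow> \<exists>q. homeomorphism u T p q"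
    using cov unfolding covering_space_def by metis
  let ?T = "S \<inter> g -` T" and ?lift = "\<lambda>u. ?E \<inter> (UNIV \<times> u)"
  have TS: "openin (top_of_set S) ?T"
    using continuous_openin_preimage[OF g(1)] g(2) T(2) by blast
  have U: "\<Union> (?lift ` v) = ?E \<inter> fst -` ?T"
  proof (rule set_eqI)
    fix y :: "'c \<times> 'a"
    obtain z w where y: "y = (z, w)" by (cases y)
    have "y \<in> \<Union> (?lift ` v) \<longleftrightarrow> y \<in> ?E \<and> w \<in> \<Union> v" unfolding y by blast
    also have "\<dots> \<longleftrightarrow> y \<in> ?E \<inter> fst -` ?T" unfolding v(1) y by auto
    finally show "y \<in> \<Union> (?lift ` v) \<longleftrightarrow> y \<in> ?E \<inter> fst -` ?T" .
  qed
  have op: "openin (top_of_set ?E) (?lift u)" if u: "u \<in> v" for u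
  proof -
    obtain O' where O': "open O'" "u = C \<inter> O'" using v(2)[OF u] by (auto simp: openin_open)
    have "?lift u = ?E \<inter> ((UNIV :: 'c set) \<times> O')" using O' by auto
    moreover have "open ((UNIV :: 'c set) \<times> O')" by (intro open_Times open_UNIV O'(1))
    ultimately show ?thesis using openin_open_Int by simp
  qed
  have disj: "pairwise disjnt (?lift ` v)"
  proof (rule pairwise_imageI)
    fix u u' assume "u \<in> v" "u' \<in> v" "u \<noteq> u'"
    then have "u \<inter> u' = {}" using v(3) by (simp add: pairwise_def disjnt_def)
    then show "disjnt (?lift u) (?lift u')" unfolding disjnt_def by blast
  qed
  have hom: "\<exists>q. homeomorphism (?lift u) ?T fst q" if u: "u \<in> v" for u
  proof -
    obtain q where q: "homeomorphism u T p q" using v(4)[OF u] by blast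
    have uC: "u \<subseteq> C" "p ` u = T"
      by (rule openin_imp_subset[OF v(2)[OF u]], rule homeomorphism_image1[OF q])
    have qT: "\<And>t. t \<in> T \<Longrightarrow> q t \<in> u" "\<And>t. t \<in> T \<Longrightarrow> p (q t) = t" "\<And>w. w \<in> u \<Longrightarrow> q (p w) = w"
      using q by (auto simp: homeomorphism_def)
    have "continuous_on ?T (q \<circ> g)"
    proof (rule continuous_on_compose)
      show "continuous_on ?T g" by (rule continuous_on_subset[OF g(1)]) simp
      show "continuous_on (g ` ?T) q"
        by (rule continuous_on_subset[OF homeomorphism_cont2[OF q]]) auto
    qed
    then have c: "continuous_on ?T (\<lambda>z. (z, q (g z)))"
      by (intro continuous_intros) (simp add: o_def)
    have "homeomorphism (?lift u) ?T fst (\<lambda>z. (z, q (g z)))"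
    proof
      show "continuous_on (?lift u) fst" by (intro continuous_intros)
      show "continuous_on ?T (\<lambda>z. (z, q (g z)))" by (rule c)
      show "fst ` ?lift u \<subseteq> ?T" using uC by force
      show "(\<lambda>z. (z, q (g z))) ` ?T \<subseteq> ?lift u" using qT uC by auto
      show "(fst y, q (g (fst y))) = y" if "y \<in> ?lift u" for y
      proof -
        obtain z w where "y = (z, w)" by (cases y)
        moreover from this have "w \<in> u" "p w = g z" using that by auto
        ultimately show ?thesis using qT(3)[of w] by simp
      qed
    qed simp
    then show ?thesis by blast
  qed
  show "\<exists>T. x \<in> T \<and> openin (top_of_set S) T \<and>
          (\<exists>v. \<Union>v = ?E \<inter> fst -` T \<and> (\<forall>u\<in>v. openin (top_of_set ?E) u) \<and> pairwise disjnt v \<and>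
               (\<forall>u\<in>v. \<exists>q. homeomorphism u T fst q))"
  proof (intro exI conjI)
    show "x \<in> ?T" using \<open>x \<in> S\<close> T(1) by simp
    show "\<forall>u\<in>?lift ` v. openin (top_of_set ?E) u" using op by (simp only: ball_simps) simp
    show "\<forall>u\<in>?lift ` v. \<exists>q. homeomorphism u ?T fst q" using hom by (simp only: ball_simps) simp
  qed (fact TS U disj)+
qed

text \<open>
  The result \<open>covering_space_lift_strong\<close> is about a base in a normed space, which a surface does
  not provide. Pulling the covering back along \<open>g\<close> makes \<open>S\<close> the base, and the lift of the
  identity of \<open>S\<close> is a section whose second component lifts \<open>g\<close>.
\<close>

lemma covering_space_lift_to_topological_space:
  fixes p :: "'a::real_normed_vector \<Rightarrow> 'b::topological_space"
    and g :: "'c::real_normed_vector \<Rightarrow> 'b"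
  assumes cov: "covering_space C p X" and S: "simply_connected S" "locally path_connected S"
    and g: "continuous_on S g" "g \<in> S \<rightarrow> X" and z: "z \<in> S" and w: "w \<in> C" "p w = g z"
  obtains G where "continuous_on S G" "G \<in> S \<rightarrow> C" "G z = w" "\<And>x. x \<in> S \<Longrightarrow> p (G x) = g x"
proof -
  let ?E = "{(z, w). z \<in> S \<and> w \<in> C \<and> p w = g z}"
  have "(z, w) \<in> ?E" using z w by auto
  obtain s where s: "continuous_on S s" "s \<in> S \<rightarrow> ?E" "s z = (z, w)"
    "\<And>y. y \<in> S \<Longrightarrow> fst (s y) = y"
  proof (rule covering_space_lift_strong[OF covering_space_pullback[OF cov g] \<open>(z, w) \<in> ?E\<close> z S])
    show "continuous_on S (\<lambda>x. x)" "(\<lambda>x. x) \<in> S \<rightarrow> S" "z = fst (z, w)" by auto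
  qed (rule that)
  have sE: "s x \<in> ?E" if "x \<in> S" for x using s(2) that by (rule funcset_mem)
  show thesis
  proof
    show "continuous_on S (snd \<circ> s)"
      using s(1) by (auto intro!: continuous_intros simp: o_def)
    show "snd \<circ> s \<in> S \<rightarrow> C" using sE by fastforce
    show "(snd \<circ> s) z = w" using s(3) by simp
    show "p ((snd \<circ> s) x) = g x" if "x \<in> S" for x
      using sE[OF that] s(4)[OF that] by auto
  qed
qed

text \<open>
  Finitely many images of closed balls cover \<open>K\<close>, as \<open>p\<close> is open. The part of these balls
  lying over \<open>K\<close> is closed in their union because \<open>K\<close>, being compact in a Hausdorff space, is
  closed.
\<close>

lemma covering_space_compact_lift:
  fixes C :: "'a::heine_borel set" and X :: "'b::t2_space set"
  assumes cov: "covering_space C p X" and C: "open C" and K: "compact K" "K \<subseteq> X"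
  obtains K' where "compact K'" "K' \<subseteq> C" "p ` K' = K"
proof -
  have "\<exists>y e O'. p y = x \<and> cball y e \<subseteq> C \<and> open O' \<and> x \<in> O' \<and> X \<inter> O' \<subseteq> p ` cball y e"
    if x: "x \<in> K" for x
  proof -
    obtain y where y: "y \<in> C" "p y = x"
      using covering_space_imp_surjective[OF cov] x K by blast
    obtain e where e: "e > 0" "cball y e \<subseteq> C" using C y open_contains_cball by blast
    then have "ball y e \<subseteq> C" by auto
    then have "openin (top_of_set C) (ball y e)" by (simp add: open_subset)
    then have "openin (top_of_set X) (p ` ball y e)" by (rule covering_space_is_open_map[OF cov])
    then obtain O' where O': "open O'" "p ` ball y e = X \<inter> O'" unfolding openin_open by blast
    have "x \<in> p ` ball y e" using y e by force
    then have "x \<in> O'" using O' by blast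
    moreover have "X \<inter> O' \<subseteq> p ` cball y e" unfolding O'(2)[symmetric] by (intro image_mono) auto
    ultimately show ?thesis using y e O' by blast
  qed
  then obtain y e W where W: "\<And>x. x \<in> K \<Longrightarrow> cball (y x) (e x) \<subseteq> C \<and> open (W x) \<and> x \<in> W x \<and>
      X \<inter> W x \<subseteq> p ` cball (y x) (e x)" by metis
  obtain I where I: "I \<subseteq> K" "finite I" "K \<subseteq> (\<Union>x\<in>I. W x)"
    using compactE_image[OF K(1), of K W] W by (metis UN_I subsetI)
  define M where "M = (\<Union>x\<in>I. cball (y x) (e x))"
  have M: "compact M" unfolding M_def using I(2) by (intro compact_UN) auto
  have "M \<subseteq> C" unfolding M_def using I(1) W by blast
  have "continuous_on M p"
    using covering_space_imp_continuous[OF cov] \<open>M \<subseteq> C\<close> continuous_on_subset by blast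
  then have "closed (M \<inter> p -` K)"
    by (intro continuous_closed_preimage compact_imp_closed M K)
  then have "compact (M \<inter> (M \<inter> p -` K))" using M by (intro compact_Int_closed)
  moreover have "K \<subseteq> p ` (M \<inter> (M \<inter> p -` K))"
  proof
    fix x assume "x \<in> K"
    then obtain i where "i \<in> I" "x \<in> W i" using I by blast
    then have "x \<in> p ` cball (y i) (e i)" using W[of i] I K \<open>x \<in> K\<close> by blast
    then show "x \<in> p ` (M \<inter> (M \<inter> p -` K))" using \<open>i \<in> I\<close> \<open>x \<in> K\<close> unfolding M_def by blast
  qed
  ultimately show thesis using \<open>M \<subseteq> C\<close> that[of "M \<inter> (M \<inter> p -` K)"] by blast
qed

section \<open>Convergence in the space of holomorphic self-maps\<close>

text \<open>
  Convergence can be tested on a subbase, since the eventual membership that it requires is stable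
  under finite intersections and under enlarging the set.
\<close>

lemma limitin_Hol_topologyI:
  assumes "\<And>n. g n \<in> Hol X A" "l \<in> Hol X A"
    and sub: "\<And>K U. \<lbrakk>compact K; K \<subseteq> X; openin (top_of_set X) U; l ` K \<subseteq> U\<rbrakk>
           \<Longrightarrow> \<forall>\<^sub>F n in F. g n ` K \<subseteq> U"
  shows "limitin (Hol_topology X A) g l F"
  unfolding limitin_def
proof (intro conjI allI impI; (elim conjE)?)
  show "l \<in> topspace (Hol_topology X A)" using assms by simp
  fix U assume "openin (Hol_topology X A) U" and l: "l \<in> U"
  then have "generate_topology_on {{f \<in> Hol X A. f ` K \<subseteq> U} | K U.
      compact K \<and> K \<subseteq> X \<and> openin (top_of_set X) U} U"
    unfolding Hol_topology_def by (simp add: openin_topology_generated_by_iff)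
  then show "\<forall>\<^sub>F n in F. g n \<in> U" using l
  proof induction
    case (Int a b)
    then show ?case by (auto intro: eventually_conj)
  next
    case (UN \<K>)
    then obtain k where "k \<in> \<K>" "l \<in> k" by blast
    then have "\<forall>\<^sub>F n in F. g n \<in> k" using UN.IH by blast
    then show ?case using \<open>k \<in> \<K>\<close> by (auto elim: eventually_mono)
  next
    case (Basis s)
    then show ?case using assms(1) sub by auto
  qed auto
qed

lemma limitin_Hol_topology_at_point:
  assumes lim: "limitin (Hol_topology X A) g l F" and x: "x \<in> X"
    and U: "openin (top_of_set X) U" "l x \<in> U"
  shows "\<forall>\<^sub>F n in F. g n x \<in> U"
proof -
  let ?N = "{f \<in> Hol X A. f ` {x} \<subseteq> U}"
  have "openin (Hol_topology X A) ?N" unfolding Hol_topology_def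
  proof (intro topology_generated_by_Basis CollectI, rule exI[of _ "{x}"], rule exI[of _ U])
    show "?N = ?N \<and> compact {x} \<and> {x} \<subseteq> X \<and> openin (top_of_set X) U" using x U by simp
  qed
  moreover have "l \<in> Hol X A" using limitin_topspace[OF lim] by simp
  then have "l \<in> ?N" using U by simp
  ultimately have "\<forall>\<^sub>F n in F. g n \<in> ?N" using lim by (simp only: limitin_def)
  then show ?thesis by eventually_elim auto
qed

text \<open>
  If \<open>K\<close> lies in the open set \<open>U\<close>, a compact lift \<open>K'\<close> of \<open>K\<close> has a positive distance from
  the complement of the preimage of \<open>U\<close>. Once \<open>G n\<close> moves the points of \<open>K'\<close> by less than this
  distance, \<open>g n\<close> maps \<open>K\<close> into \<open>U\<close>.
\<close>

lemma limitin_Hol_id_if_lifts_tend_to_id: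
  fixes C :: "'c::{heine_borel, real_normed_vector} set" and X :: "'a::t2_space set"
  assumes X: "riemann_surface X A" and cov: "covering_space C p X" and C: "open C"
    and g: "\<And>n. g n \<in> Hol X A"
    and G: "\<And>n. G n \<in> C \<rightarrow> C" "\<And>n z. z \<in> C \<Longrightarrow> p (G n z) = g n (p z)"
    and lim: "\<And>K. compact K \<Longrightarrow> K \<subseteq> C \<Longrightarrow> uniform_limit K G (\<lambda>z. z) F"
  shows "limitin (Hol_topology X A) g id F"
proof (rule limitin_Hol_topologyI[OF g id_in_Hol[OF X]])
  fix K U assume K: "compact K" "K \<subseteq> X" and U: "openin (top_of_set X) U" and "id ` K \<subseteq> U"
  obtain K' where K': "compact K'" "K' \<subseteq> C" "p ` K' = K"
    using covering_space_compact_lift[OF cov C K] .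
  define W where "W = C \<inter> p -` U"
  have "openin (top_of_set C) W" unfolding W_def
    using continuous_openin_preimage[OF covering_space_imp_continuous[OF cov] _ U]
      covering_space_imp_surjective[OF cov] by blast
  then have "open W" using C openin_open_trans by blast
  moreover have "K' \<subseteq> W" unfolding W_def using K' \<open>id ` K \<subseteq> U\<close> by auto
  ultimately obtain e where e: "e > 0" "(\<Union>x\<in>K'. ball x e) \<subseteq> W"
    using compact_subset_open_imp_ball_epsilon_subset[OF K'(1)] by blast
  have "\<forall>\<^sub>F n in F. \<forall>z\<in>K'. dist (G n z) z < e"
    using lim[OF K'(1,2)] e(1) unfolding uniform_limit_iff by blast
  then show "\<forall>\<^sub>F n in F. g n ` K \<subseteq> U"
  proof eventually_elim
    case (elim n)
    show ?case
    proof
      fix y assume "y \<in> g n ` K"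
      then obtain z where z: "z \<in> K'" "y = g n (p z)" using K'(3) by blast
      then have "G n z \<in> ball z e" using elim by (simp add: dist_commute)
      then have "G n z \<in> W" using e(2) z by blast
      then show "y \<in> U" using G(2)[of z n] z K' by (auto simp: W_def)
    qed
  qed
qed

section \<open>Lifts of holomorphic self-maps\<close>

lemma holomorphic_map_unit_disc_chart:
  assumes "holomorphic_map unit_disc unit_disc_atlas X A p" "(U, \<phi>) \<in> A"
  shows "(\<phi> \<circ> p) holomorphic_on (unit_disc \<inter> p -` U)"
proof -
  have "(\<phi> \<circ> p \<circ> inv_into unit_disc (\<lambda>z. z)) holomorphic_on (\<lambda>z. z) ` (unit_disc \<inter> p -` U)"
    using assms unfolding holomorphic_map_def by fast
  moreover have "inv_into unit_disc (\<lambda>z. z) z = z" if "z \<in> unit_disc" for z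
    using inv_into_f_f[of "\<lambda>z. z" unit_disc z] that by simp
  ultimately show ?thesis
    by (auto elim!: holomorphic_transform)
qed

text \<open>
  In charts, \<open>\<psi> \<circ> p\<close> is holomorphic and injective near \<open>G z\<close>, so it has a holomorphic inverse
  \<open>k\<close>. As \<open>G\<close> is continuous, near \<open>z\<close> it equals \<open>k\<close> applied to the expression of
  \<open>f \<circ> p\<close> in charts.
\<close>

lemma holomorphic_lift:
  assumes X: "riemann_surface X A"
    and cov: "covering_space unit_disc p X"
    and p: "holomorphic_map unit_disc unit_disc_atlas X A p"
    and f: "f \<in> Hol X A"
    and G: "continuous_on unit_disc G" "G \<in> unit_disc \<rightarrow> unit_disc"
    and pG: "\<And>z. z \<in> unit_disc \<Longrightarrow> p (G z) = f (p z)"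
  shows "G holomorphic_on unit_disc"
proof -
  have pc: "continuous_on unit_disc p" and pX: "p \<in> unit_disc \<rightarrow> X"
    using p by (auto simp: holomorphic_map_def)
  have chart: "complex_chart X (U, \<phi>)" if "(U, \<phi>) \<in> A" for U \<phi>
    using X that by (auto simp: riemann_surface_def holomorphic_atlas_def)
  have cover: "\<exists>U \<phi>. (U, \<phi>) \<in> A \<and> x \<in> U" if "x \<in> X" for x
    using X that by (auto simp: riemann_surface_def holomorphic_atlas_def)
  have open_pre: "open (unit_disc \<inter> p -` U)" if "(U, \<phi>) \<in> A" for U \<phi>
    using chart[OF that] continuous_openin_preimage[OF pc pX] openin_open_trans[of unit_disc]
    by (force simp: complex_chart_def)
  have "G field_differentiable at z" if z: "z \<in> unit_disc" for z
  proof -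
    have Gz: "G z \<in> unit_disc" using G z by blast
    obtain U \<phi> where U: "(U, \<phi>) \<in> A" "p z \<in> U" using cover pX z by blast
    obtain V \<psi> where V: "(V, \<psi>) \<in> A" "p (G z) \<in> V" using cover pX Gz by blast
    obtain T q Y where T: "G z \<in> T" "openin (top_of_set unit_disc) T" "homeomorphism T Y p q"
      using covering_space_local_homeomorphism[OF cov Gz] by metis
    define W where "W = T \<inter> (unit_disc \<inter> p -` V)"
    have "open T" using T(2) openin_open_trans by blast
    then have W: "open W" "G z \<in> W" unfolding W_def using open_pre[OF V(1)] T V Gz by auto
    have "inj_on \<psi> V" using chart[OF V(1)]
      by (auto simp: complex_chart_def homeomorphism_def intro: inj_on_inverseI)
    moreover have "inj_on p T" using T(3) by (auto simp: homeomorphism_def intro: inj_on_inverseI)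
    ultimately have inj: "inj_on (\<psi> \<circ> p) W"
      unfolding W_def by (auto simp: inj_on_def)
    have "(\<psi> \<circ> p) holomorphic_on W"
      by (rule holomorphic_on_subset[OF holomorphic_map_unit_disc_chart[OF p V(1)]]) (auto simp: W_def)
    then obtain k where k: "k holomorphic_on ((\<psi> \<circ> p) ` W)"
        "\<And>w. w \<in> W \<Longrightarrow> k ((\<psi> \<circ> p) w) = w"
      using holomorphic_has_inverse[OF _ W(1) inj] by metis
    define N where "N = (unit_disc \<inter> p -` U) \<inter> (unit_disc \<inter> G -` W)"
    have "open (unit_disc \<inter> G -` W)"
      using G(1) W(1) by (simp add: continuous_open_preimage)
    then have N: "open N" "z \<in> N" unfolding N_def using open_pre[OF U(1)] U W z by auto
    \<comment> \<open>\<open>t\<close> is \<open>f\<close> read in the charts at \<open>p z\<close> and at \<open>f (p z)\<close>.\<close>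
    define t where "t = \<psi> \<circ> f \<circ> inv_into U \<phi>"
    have t: "t holomorphic_on \<phi> ` (U \<inter> f -` V)"
      using f U(1) V(1) unfolding Hol_def holomorphic_map_def t_def by fast
    have inv: "inv_into U \<phi> (\<phi> x) = x" if "x \<in> U" for x
      using chart[OF U(1)] that by (auto simp: complex_chart_def homeomorphism_def)
    have tN: "t ((\<phi> \<circ> p) x) = (\<psi> \<circ> p) (G x)" if "x \<in> N" for x
      using that pG[of x] inv[of "p x"] by (auto simp: t_def N_def)
    have h1: "(\<phi> \<circ> p) holomorphic_on N"
      by (rule holomorphic_on_subset[OF holomorphic_map_unit_disc_chart[OF p U(1)]]) (auto simp: N_def)
    have "(\<phi> \<circ> p) ` N \<subseteq> \<phi> ` (U \<inter> f -` V)"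
    proof clarsimp
      fix x assume x: "x \<in> N"
      then have "f (p x) = p (G x)" "G x \<in> W" "p x \<in> U" using pG[of x] by (auto simp: N_def)
      then show "\<phi> (p x) \<in> \<phi> ` (U \<inter> f -` V)" by (auto simp: W_def)
    qed
    then have h2: "(t \<circ> (\<phi> \<circ> p)) holomorphic_on N"
      using holomorphic_on_compose[OF h1] t holomorphic_on_subset by blast
    have "(t \<circ> (\<phi> \<circ> p)) ` N \<subseteq> (\<psi> \<circ> p) ` W"
      using tN by (auto simp: N_def)
    then have "(k \<circ> (t \<circ> (\<phi> \<circ> p))) holomorphic_on N"
      using holomorphic_on_compose[OF h2] k(1) holomorphic_on_subset by blast
    moreover have "(k \<circ> (t \<circ> (\<phi> \<circ> p))) x = G x" if "x \<in> N" for x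
      using tN[OF that] k(2)[of "G x"] that by (simp add: N_def)
    ultimately have "G holomorphic_on N" by (rule holomorphic_transform)
    then show ?thesis using N holomorphic_on_imp_differentiable_at by blast
  qed
  then show ?thesis
    by (simp add: holomorphic_on_def field_differentiable_at_within)
qed

section \<open>Fixed points near the limit\<close>

text \<open>
  The points \<open>c n\<close> force every subsequential limit \<open>g\<close> of \<open>G\<close> to fix \<open>a\<close>. If the maps of the
  subsequence had no fixed points near \<open>a\<close>, Hurwitz's theorem would forbid the zero of
  \<open>g z - z\<close> at \<open>a\<close> unless this difference is constant near \<open>a\<close>. In that case it vanishes on all of
  \<open>S\<close>, against the assumption that no subsequence tends to the identity.
\<close>

lemma eventually_fixed_point_near_limit:
  fixes G :: "nat \<Rightarrow> complex \<Rightarrow> complex"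
  assumes S: "open S" "connected S" and hol: "\<And>n. G n holomorphic_on S"
    and bound: "\<And>n z. z \<in> S \<Longrightarrow> norm (G n z) \<le> B"
    and c: "\<And>n. c n \<in> S" "c \<longlonglongrightarrow> a" "(\<lambda>n. G n (c n)) \<longlonglongrightarrow> a" and a: "a \<in> S"
    and not_id: "\<And>r :: nat \<Rightarrow> nat. strict_mono r \<Longrightarrow>
       (\<And>K. compact K \<Longrightarrow> K \<subseteq> S \<Longrightarrow> uniform_limit K (G \<circ> r) (\<lambda>z. z) sequentially) \<Longrightarrow> False"
    and e: "e > 0"
  shows "\<forall>\<^sub>F n in sequentially. \<exists>z\<in>{z \<in> S. G n z = z}. dist z a < e"
proof (rule ccontr)
  assume "\<not> ?thesis"
  from not_eventually_sequentiallyD[OF this] obtain s :: "nat \<Rightarrow> nat" where s: "strict_mono s"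
    and nofix: "\<And>n z. z \<in> S \<Longrightarrow> dist z a < e \<Longrightarrow> G (s n) z \<noteq> z"
    by blast
  obtain g r where g: "g holomorphic_on S" and r: "strict_mono (r :: nat \<Rightarrow> nat)"
    and ul: "\<And>K. compact K \<Longrightarrow> K \<subseteq> S \<Longrightarrow> uniform_limit K ((G \<circ> s) \<circ> r) g sequentially"
  proof (rule Montel[OF S(1), of "range G" "G \<circ> s"])
    show "\<exists>B. \<forall>h\<in>range G. \<forall>z\<in>K. norm (h z) \<le> B" if "K \<subseteq> S" for K
      using bound that by (intro exI[of _ B]) auto
  qed (use hol in auto)
  define t where "t = s \<circ> r"
  have t: "strict_mono t" unfolding t_def using s r strict_mono_o by blast
  have ul: "uniform_limit K (G \<circ> t) g sequentially" if "compact K" "K \<subseteq> S" for K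
    using ul[OF that] by (simp add: t_def comp_assoc)
  have ct: "(\<lambda>n. c (t n)) \<longlonglongrightarrow> a" and Gct: "(\<lambda>n. G (t n) (c (t n))) \<longlonglongrightarrow> a"
    using LIMSEQ_subseq_LIMSEQ[OF c(2) t] LIMSEQ_subseq_LIMSEQ[OF c(3) t] by (auto simp: o_def)
  have ga: "g a = a"
  proof (rule LIMSEQ_unique)
    have "isCont g a"
      using g S a continuous_on_eq_continuous_at holomorphic_on_imp_continuous_on by blast
    then have 1: "(\<lambda>n. g (c (t n))) \<longlonglongrightarrow> g a" using ct by (rule isCont_tendsto_compose)
    \<comment> \<open>Uniform convergence on this compact set allows evaluation at the moving points \<open>c (t n)\<close>.\<close>
    let ?K = "insert a (range (\<lambda>n. c (t n)))"
    have K: "compact ?K" "?K \<subseteq> S" using compact_sequence_with_limit[OF ct] c a by auto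
    have "(\<lambda>n. dist (G (t n) (c (t n))) (g (c (t n)))) \<longlonglongrightarrow> 0"
    proof (rule tendstoI)
      fix d :: real assume "d > 0"
      then have "\<forall>\<^sub>F n in sequentially. \<forall>x\<in>?K. dist ((G \<circ> t) n x) (g x) < d"
        using ul[OF K] unfolding uniform_limit_iff by blast
      then show "\<forall>\<^sub>F n in sequentially. dist (dist (G (t n) (c (t n))) (g (c (t n)))) 0 < d"
        by eventually_elim simp
    qed
    then have 2: "(\<lambda>n. G (t n) (c (t n)) - g (c (t n))) \<longlonglongrightarrow> 0"
      by (simp add: dist_norm tendsto_norm_zero_iff)
    show "(\<lambda>n. G (t n) (c (t n))) \<longlonglongrightarrow> g a" using tendsto_add[OF 2 1] by simp
    show "(\<lambda>n. G (t n) (c (t n))) \<longlonglongrightarrow> a" by (rule Gct)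
  qed
  obtain d where d: "d > 0" "d \<le> e" "ball a d \<subseteq> S"
  proof -
    obtain d where "d > 0" "ball a d \<subseteq> S" using S a openE by blast
    moreover then have "ball a (min d e) \<subseteq> S" by (meson min.cobounded1 order_trans subset_ball)
    ultimately show thesis using that[of "min d e"] e by simp
  qed
  have const: "(\<lambda>z. g z - z) constant_on ball a d"
  proof (rule ccontr)
    assume nonconst: "\<not> (\<lambda>z. g z - z) constant_on ball a d"
    have "g a - a \<noteq> 0"
    proof (rule Hurwitz_no_zeros[where \<F> = "\<lambda>n z. G (t n) z - z" and S = "ball a d"
          and g = "\<lambda>z. g z - z" and ?z0.0 = a])
      show "(\<lambda>z. G (t n) z - z) holomorphic_on ball a d" for n
        using hol d holomorphic_on_subset by (intro holomorphic_intros) blast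
      show "(\<lambda>z. g z - z) holomorphic_on ball a d"
        using g d holomorphic_on_subset by (intro holomorphic_intros) blast
      show "uniform_limit K (\<lambda>n z. G (t n) z - z) (\<lambda>z. g z - z) sequentially"
        if "compact K" "K \<subseteq> ball a d" for K
        using ul[of K] that d by (intro uniform_limit_intros) (auto simp: o_def)
      show "G (t n) z - z \<noteq> 0" if "z \<in> ball a d" for n z
        using nofix[of z "r n"] that d by (auto simp: t_def dist_commute)
    qed (use nonconst d in auto)
    then show False using ga by simp
  qed
  have "g z - z = 0" if "z \<in> S" for z
  proof (rule analytic_continuation_open[of "ball a d" S "\<lambda>z. g z - z" "\<lambda>_. 0"])
    fix w assume "w \<in> ball a d"
    then show "g w - w = 0"
      using const ga d unfolding constant_on_def by (metis centre_in_ball diff_self)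
  qed (use S d g that in \<open>auto intro!: holomorphic_intros\<close>)
  then have gid: "g z = z" if "z \<in> S" for z using that by simp
  show False
  proof (rule not_id[OF t])
    fix K assume K: "compact K" "K \<subseteq> S"
    show "uniform_limit K (G \<circ> t) (\<lambda>z. z) sequentially"
      using ul[OF K] K(2) gid
      by (subst uniform_limit_cong'[where g = "G \<circ> t" and i = g]) auto
  qed
qed

text \<open>
  The sets \<open>S n\<close> need not contain a point nearest to \<open>a\<close>. It is enough to pick a point whose
  distance from \<open>a\<close> exceeds the infimum by less than \<open>1 / (n + 1)\<close>.
\<close>

lemma convergent_selection:
  fixes a :: "'a::metric_space"
  assumes near: "\<And>e. e > 0 \<Longrightarrow> \<forall>\<^sub>F n in sequentially. \<exists>z\<in>S n. dist z a < e"
  shows "\<exists>b. (\<forall>\<^sub>F n in sequentially. b n \<in> S n) \<and> b \<longlonglongrightarrow> a"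
proof -
  have "\<exists>z. S n \<noteq> {} \<longrightarrow> z \<in> S n \<and> dist a z < infdist a (S n) + inverse (Suc n)" for n
    using cInf_lessD[of "dist a ` S n" "infdist a (S n) + inverse (Suc n)"]
    by (auto simp: infdist_notempty)
  then obtain b where b: "\<And>n. S n \<noteq> {} \<Longrightarrow> b n \<in> S n \<and> dist a (b n) < infdist a (S n) + inverse (Suc n)"
    by metis
  have "\<forall>\<^sub>F n in sequentially. b n \<in> S n"
    using near[OF zero_less_one] by eventually_elim (use b in blast)
  moreover have "b \<longlonglongrightarrow> a"
  proof (rule tendstoI)
    fix e :: real assume "e > 0"
    then have "\<forall>\<^sub>F n in sequentially. \<exists>z\<in>S n. dist z a < e / 2" by (intro near) simp
    moreover have "\<forall>\<^sub>F n in sequentially. inverse (real (Suc n)) < e / 2"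
      using \<open>e > 0\<close> by (intro order_tendstoD(2)[OF LIMSEQ_inverse_real_of_nat]) simp
    ultimately show "\<forall>\<^sub>F n in sequentially. dist (b n) a < e"
    proof eventually_elim
      case (elim n)
      then obtain z where z: "z \<in> S n" "dist z a < e / 2" by blast
      then have "infdist a (S n) < e / 2" using infdist_le[of z "S n" a] by (simp add: dist_commute)
      moreover have "dist a (b n) < infdist a (S n) + inverse (real (Suc n))" using b z by blast
      ultimately show ?case using elim(2) dist_commute[of "b n" a] by linarith
    qed
  qed
  ultimately show ?thesis by blast
qed

theorem theoremH:
  fixes X :: "'a::t2_space set" and A :: "'a chart set"
    and F :: "('a \<Rightarrow> 'a) set" and f :: "nat \<Rightarrow> 'a \<Rightarrow> 'a" and a :: 'a
  assumes "hyperbolic_riemann_surface X A"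
    and "F \<subseteq> Hol X A"
    and "id \<notin> Hol_topology X A closure_of F"
    and "\<And>n. n \<ge> 1 \<Longrightarrow> f n \<in> F"
    and "a \<in> X"
    and "limitin (Hol_topology X A) (left_ifs f) (\<lambda>_. a) sequentially"
  shows "\<exists>b. (\<forall>\<^sub>F n in sequentially. b n \<in> X \<and> f n (b n) = b n) \<and> b \<longlonglongrightarrow> a"
proof -
  obtain p where X: "riemann_surface X A" and cov: "covering_space unit_disc p X"
    and p: "holomorphic_map unit_disc unit_disc_atlas X A p"
    using assms(1) unfolding hyperbolic_riemann_surface_def by blast
  have pc: "continuous_on unit_disc p" and pX: "p \<in> unit_disc \<rightarrow> X"
    using p by (auto simp: holomorphic_map_def)
  obtain a' T Y q where a': "p a' = a" "a' \<in> T" "openin (top_of_set unit_disc) T"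
    and Y: "a \<in> Y" "openin (top_of_set X) Y" and q: "homeomorphism T Y p q"
    using covering_space_local_homeomorphism_alt[OF cov \<open>a \<in> X\<close>] by metis
  have T: "T \<subseteq> unit_disc" using a'(3) openin_imp_subset by blast
  define c where "c n = left_ifs f n a" for n
  have c_near: "\<forall>\<^sub>F n in sequentially. c n \<in> U" if "openin (top_of_set X) U" "a \<in> U" for U
    unfolding c_def using limitin_Hol_topology_at_point[OF assms(6,5) that(1)] that(2) by simp
  obtain N where N: "\<And>n. n \<ge> N \<Longrightarrow> c n \<in> Y"
    using c_near[OF Y(2,1)] unfolding eventually_sequentially by blast
  \<comment> \<open>From \<open>N\<close> on the orbit stays in \<open>Y\<close>, where the inverse \<open>q\<close> of \<open>p\<close> is available.\<close>
  define c' where "c' k = q (c (N + k))" for k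
  have c'T: "c' k \<in> T" "p (c' k) = c (N + k)" for k
    using N[of "N + k"] q by (auto simp: c'_def homeomorphism_def)
  have c'_lim: "c' \<longlonglongrightarrow> a'"
  proof (rule topological_tendstoI)
    fix O' :: "complex set" assume "open O'" "a' \<in> O'"
    then have "openin (top_of_set Y) (Y \<inter> q -` O')"
      using homeomorphism_cont2[OF q] continuous_openin_preimage_gen by blast
    then have "openin (top_of_set X) (Y \<inter> q -` O')" using Y(2) openin_trans by blast
    moreover have "a \<in> Y \<inter> q -` O'"
      using Y(1) a' \<open>a' \<in> O'\<close> q by (auto simp: homeomorphism_def)
    ultimately have "\<forall>\<^sub>F n in sequentially. c n \<in> Y \<inter> q -` O'" by (rule c_near)
    then have "\<forall>\<^sub>F n in sequentially. c (n + N) \<in> Y \<inter> q -` O'"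
      by (rule sequentially_offset)
    then show "\<forall>\<^sub>F n in sequentially. c' n \<in> O'"
      by eventually_elim (simp add: c'_def add.commute)
  qed
  define g where "g k = f (Suc (N + k))" for k
  have gF: "g k \<in> F" for k unfolding g_def by (rule assms(4)) simp
  then have gH: "g k \<in> Hol X A" for k using assms(2) by blast
  have gc: "g k (c (N + k)) = c (N + Suc k)" for k by (simp add: g_def c_def)
  \<comment> \<open>Among the lifts of \<open>g k \<circ> p\<close> the one that carries the lifted orbit along is chosen.\<close>
  have "\<exists>G. continuous_on unit_disc G \<and> G \<in> unit_disc \<rightarrow> unit_disc \<and> G (c' k) = c' (Suc k) \<and>
      (\<forall>x\<in>unit_disc. p (G x) = g k (p x))" for k
  proof -
    have g: "continuous_on X (g k)" "g k \<in> X \<rightarrow> X"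
      using gH[of k] by (auto simp: Hol_def holomorphic_map_def)
    have 1: "continuous_on unit_disc (g k \<circ> p)"
      using pX by (intro continuous_on_compose pc continuous_on_subset[OF g(1)]) blast
    have 2: "g k \<circ> p \<in> unit_disc \<rightarrow> X" using g(2) pX by auto
    have 3: "c' k \<in> unit_disc" "c' (Suc k) \<in> unit_disc" using c'T T by blast+
    have 4: "p (c' (Suc k)) = (g k \<circ> p) (c' k)" using c'T(2) gc by simp
    show ?thesis
      by (rule covering_space_lift_to_topological_space[OF cov _ _ 1 2 3 4])
        (auto simp: convex_imp_simply_connected convex_imp_locally_path_connected)
  qed
  then obtain G where G: "\<And>k. continuous_on unit_disc (G k)" "\<And>k. G k \<in> unit_disc \<rightarrow> unit_disc"
    "\<And>k. G k (c' k) = c' (Suc k)" "\<And>k x. x \<in> unit_disc \<Longrightarrow> p (G k x) = g k (p x)"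
    by metis
  have hol: "G k holomorphic_on unit_disc" for k
    using holomorphic_lift[OF X cov p gH G(1,2)] G(4) by blast
  have near: "\<forall>\<^sub>F k in sequentially. \<exists>z\<in>{z \<in> unit_disc. G k z = z}. dist z a' < e" if "e > 0" for e
  proof (rule eventually_fixed_point_near_limit[where c = c' and B = 1])
    show "norm (G k z) \<le> 1" if "z \<in> unit_disc" for k z
      using funcset_mem[OF G(2) that, of k] by simp
    show "(\<lambda>k. G k (c' k)) \<longlonglongrightarrow> a'" using c'_lim by (simp add: G(3) LIMSEQ_Suc)
    show "c' k \<in> unit_disc" for k using c'T T by blast
    show "a' \<in> unit_disc" using a' T by blast
    fix r :: "nat \<Rightarrow> nat"
    assume ul: "\<And>K. compact K \<Longrightarrow> K \<subseteq> unit_disc \<Longrightarrow> uniform_limit K (G \<circ> r) (\<lambda>z. z) sequentially"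
    have lim: "limitin (Hol_topology X A) (g \<circ> r) id sequentially"
      by (rule limitin_Hol_id_if_lifts_tend_to_id[OF X cov open_ball _ _ _ ul]) (use gH G in auto)
    have "\<exists>h\<in>F. h \<in> U" if "openin (Hol_topology X A) U" "id \<in> U" for U
    proof -
      have "\<forall>\<^sub>F k in sequentially. (g \<circ> r) k \<in> U" using lim that unfolding limitin_def by blast
      then obtain k where "(g \<circ> r) k \<in> U" using eventually_happens' sequentially_bot by blast
      then show ?thesis using gF by auto
    qed
    then have "id \<in> Hol_topology X A closure_of F"
      using id_in_Hol[OF X] by (auto simp: in_closure_of)
    then show False using assms(3) by contradiction
  qed (use hol c'_lim that in auto)
  obtain b where b: "\<forall>\<^sub>F k in sequentially. b k \<in> {z \<in> unit_disc. G k z = z}" and b_lim: "b \<longlonglongrightarrow> a'"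
    using convergent_selection[of "\<lambda>k. {z \<in> unit_disc. G k z = z}", OF near] by blast
  have "isCont p a'"
    using pc a'(2) T continuous_on_eq_continuous_at[OF open_ball] by blast
  then have pb_lim: "(\<lambda>k. p (b k)) \<longlonglongrightarrow> a"
    using isCont_tendsto_compose[OF _ b_lim, of p] a'(1) by simp
  have fixed: "\<forall>\<^sub>F k in sequentially. p (b k) \<in> X \<and> f (k + Suc N) (p (b k)) = p (b k)"
    using b
  proof eventually_elim
    case (elim k)
    then show ?case using G(4)[of "b k" k] pX by (auto simp: g_def add.commute)
  qed
  \<comment> \<open>\<open>G k\<close> lifts \<open>f (k + Suc N)\<close>, so the index is shifted back by \<open>Suc N\<close>.\<close>
  let ?b = "\<lambda>n. p (b (n - Suc N))"
  have "\<forall>\<^sub>F n in sequentially. ?b n \<in> X \<and> f n (?b n) = ?b n"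
    using fixed by (subst eventually_sequentially_seg[of _ "Suc N", symmetric]) simp
  moreover have "?b \<longlonglongrightarrow> a"
    by (rule LIMSEQ_offset[of _ "Suc N"]) (use pb_lim in simp)
  ultimately show ?thesis by (intro exI[of _ ?b] conjI)
qed

end
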